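(* Let $A=(a_{jk})_{1\le j\le m,\,1\le k\le n}$ be a random real $m\times n$ matrix with independent (not necessarily identically distributed) entries, and let $g_{jk}(s)=E\exp(is\,a_{jk})$, $s\in\mathbb R$, be the characteristic functions of the entries. Let $r\ge1$ and let $t_1,\dots,t_r>0$. Then $$E\left(\prod_{i=1}^r\det(1+t_i^2A^tA)\right)^{-1/2}=(2\pi)^{-r(n+m)/2}\int_{\mathbb R^{r(n+m)}}\prod_{i=1}^r d^ns^{(i)}\,d^mp^{(i)}\ \exp\left(-\sum_{i=1}^r\Big(\frac{|s^{(i)}|^2}{2}+\frac{|p^{(i)}|^2}{2}\Big)\right)\prod_{1\le j\le m,\ 1\le k\le n}g_{jk}\left(\sum_{i=1}^r t_i\,p_j^{(i)}s_k^{(i)}\right).$$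
   Context: Here $s^{(i)}=(s^{(i)}_1,\dots,s^{(i)}_n)\in\mathbb R^n$ and $p^{(i)}=(p^{(i)}_1,\dots,p^{(i)}_m)\in\mathbb R^m$ for $i=1,\dots,r$; $|\cdot|$ is the Euclidean norm; $d^ns^{(i)}$ and $d^mp^{(i)}$ denote Lebesgue measure; $1$ inside the determinant is the $n\times n$ identity matrix. *)

theory Defs
  imports "HOL-Probability.Probability"
begin

end

theory Submission
  imports Defs
begin

text \<open>
  For a deterministic matrix $A$, integrating
  $\exp(-|s|^2/2 - |p|^2/2 + i\,t\,p \cdot As)$ first over $p$ and then over $s$ gives
  $(2\pi)^{(n+m)/2} \det(1 + t^2 A^t A)^{-1/2}$, and a product over $r$ independent pairs $(s,p)$
  gives the product of these factors. By independence of the entries, averaging the phase over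
  the random $A$ turns it into the product of the characteristic functions. The integrand is
  dominated by the Gaussian weight, so Fubini's theorem allows both averages to be exchanged.
\<close>

section \<open>Lebesgue measure on coordinate vectors\<close>

lemma Basis_vec_eq_range: "(Basis :: (real^'n) set) = range (\<lambda>i. axis i 1)"
  by (auto simp: Basis_vec_def)

lemma inj_axis: "inj (\<lambda>i::'n::finite. axis i (1::real))"
  by (auto simp: inj_on_def axis_eq_axis)

lemma borel_measurable_vec_lambda:
  fixes f :: "'n::finite \<Rightarrow> 'a \<Rightarrow> real"
  assumes "\<And>i. f i \<in> borel_measurable M"
  shows "(\<lambda>x. \<chi> i. f i x) \<in> borel_measurable M"
  using assms by (subst borel_measurable_euclidean_space) (auto simp: Basis_vec_def inner_axis)

lemma borel_measurable_vec_nth[measurable]: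
  "(\<lambda>x::real^'n. x $ i) \<in> borel_measurable borel"
  by (intro borel_measurable_continuous_onI continuous_intros)

lemma borel_measurable_matrix_vector_mult[measurable]:
  fixes P :: "real^'n^'m"
  shows "(*v) P \<in> borel_measurable borel"
  by (intro borel_measurable_continuous_onI matrix_vector_mult_linear_continuous_on)

lemma measurable_vec_lambda_PiM[measurable]:
  "vec_lambda \<in> (\<Pi>\<^sub>M i\<in>(UNIV::'n::finite set). (lborel :: real measure)) \<rightarrow>\<^sub>M borel"
  using borel_measurable_vec_lambda[of "\<lambda>i x. x i" "\<Pi>\<^sub>M i\<in>(UNIV::'n set). (lborel :: real measure)"]
  by simp

text \<open>Lebesgue measure is determined by the volumes of boxes, and the preimage of a box under
  \<open>vec_lambda\<close> is a product of intervals. This is what makes coordinatewise Fubini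
  arguments available on \<open>real^'n\<close>.\<close>

lemma lborel_vec_eq_PiM:
  "(lborel :: (real^'n) measure) = distr (\<Pi>\<^sub>M i\<in>UNIV. lborel) borel vec_lambda"
proof (rule lborel_eqI)
  interpret product_sigma_finite "\<lambda>_::'n. lborel :: real measure" by standard
  interpret finite_product_sigma_finite "\<lambda>_::'n. lborel :: real measure" UNIV by standard simp
  fix l u :: "real^'n" assume le: "\<And>b. b \<in> Basis \<Longrightarrow> l \<bullet> b \<le> u \<bullet> b"
  have le': "l $ i \<le> u $ i" for i
    using le[of "axis i 1"] by (simp add: inner_axis axis_in_Basis_iff)
  have "vec_lambda -` box l u \<inter> space (\<Pi>\<^sub>M i\<in>(UNIV::'n set). (lborel :: real measure))
      = (\<Pi>\<^sub>E i\<in>UNIV. {l $ i <..< u $ i})"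
    by (auto simp: mem_box_cart space_PiM PiE_def Pi_iff)
  then show "emeasure (distr (\<Pi>\<^sub>M i\<in>UNIV. lborel) borel vec_lambda) (box l u) = (\<Prod>b\<in>Basis. (u - l) \<bullet> b)"
    using le' by (simp add: emeasure_distr measure_times Basis_vec_eq_range prod.reindex inj_axis
        inner_axis prod_ennreal)
qed simp

section \<open>Linear change of variables\<close>

text \<open>With all coordinates other than \<open>m\<close> held fixed, the shear only translates
  coordinate \<open>m\<close> by the constant \<open>x n\<close>, and one-dimensional Lebesgue
  measure is translation invariant.\<close>

lemma nn_integral_lborel_shear:
  fixes f :: "real^'n \<Rightarrow> ennreal"
  assumes f[measurable]: "f \<in> borel_measurable borel" and "m \<noteq> n"
  shows "(\<integral>\<^sup>+x. f (\<chi> i. if i = m then x $ m + x $ n else x $ i) \<partial>lborel) = (\<integral>\<^sup>+x. f x \<partial>lborel)"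
proof -
  interpret product_sigma_finite "\<lambda>_::'n. lborel :: real measure" by standard
  have [measurable]: "(\<lambda>x::real^'n. \<chi> i. if i = m then x $ m + x $ n else x $ i) \<in> borel_measurable borel"
    by (rule borel_measurable_vec_lambda) measurable
  have [measurable]: "(\<lambda>x. \<chi> i. if i = m then x m + x n else x i) \<in> borel_measurable (\<Pi>\<^sub>M i\<in>(UNIV::'n set). (lborel :: real measure))"
    by (rule borel_measurable_vec_lambda) measurable
  let ?J = "UNIV - {m}"
  have ins: "UNIV = insert m ?J" by auto
  \<comment> \<open>Coordinate \<open>m\<close> is integrated innermost, so that \<open>x n\<close>
    is a constant in the inner integral.\<close>
  have split: "(\<integral>\<^sup>+x. g x \<partial>(\<Pi>\<^sub>M i\<in>UNIV. lborel)) = (\<integral>\<^sup>+x. \<integral>\<^sup>+y. g (x(m := y)) \<partial>lborel \<partial>(\<Pi>\<^sub>M i\<in>?J. lborel))"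
    if "g \<in> borel_measurable (\<Pi>\<^sub>M i\<in>(UNIV::'n set). (lborel :: real measure))" for g
    using product_nn_integral_insert[of ?J m g] that by (simp flip: ins)
  have "(\<integral>\<^sup>+x. f (\<chi> i. if i = m then x $ m + x $ n else x $ i) \<partial>lborel)
      = (\<integral>\<^sup>+x. f (\<chi> i. if i = m then x m + x n else x i) \<partial>(\<Pi>\<^sub>M i\<in>UNIV. lborel))"
    by (simp add: lborel_vec_eq_PiM nn_integral_distr cong: if_cong)
  also have "\<dots> = (\<integral>\<^sup>+x. \<integral>\<^sup>+y. f (\<chi> i. if i = m then y + x n else x i) \<partial>lborel \<partial>(\<Pi>\<^sub>M i\<in>?J. lborel))"
  proof -
    have "(\<chi> i. if i = m then (x(m := y)) m + (x(m := y)) n else (x(m := y)) i) = (\<chi> i. if i = m then y + x n else x i)"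
      for x :: "'n \<Rightarrow> real" and y
      using \<open>m \<noteq> n\<close> by (simp add: vec_eq_iff)
    moreover have "(\<lambda>x. f (\<chi> i. if i = m then x m + x n else x i)) \<in> borel_measurable (\<Pi>\<^sub>M i\<in>(UNIV::'n set). (lborel :: real measure))"
      by measurable
    ultimately show ?thesis
      by (simp only: split)
  qed
  also have "\<dots> = (\<integral>\<^sup>+x. \<integral>\<^sup>+y. f (vec_lambda (x(m := y))) \<partial>lborel \<partial>(\<Pi>\<^sub>M i\<in>?J. lborel))"
  proof (rule nn_integral_cong)
    fix x :: "'n \<Rightarrow> real"
    have [measurable]: "(\<lambda>y. vec_lambda (x(m := y))) \<in> borel_measurable borel"
      unfolding fun_upd_def by (rule borel_measurable_vec_lambda) measurable
    \<comment> \<open>The shape \<open>x n + 1 * y\<close> is that of the affine substitution rule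
      with slope 1, whose scaling factor is 1.\<close>
    have "(\<chi> i. if i = m then y + x n else x i) = vec_lambda (x(m := x n + 1 * y))" for y
      by (auto simp: vec_eq_iff)
    then show "(\<integral>\<^sup>+y. f (\<chi> i. if i = m then y + x n else x i) \<partial>lborel) = (\<integral>\<^sup>+y. f (vec_lambda (x(m := y))) \<partial>lborel)"
      using nn_integral_real_affine[of "\<lambda>y. f (vec_lambda (x(m := y)))" 1 "x n"] by simp
  qed
  also have "\<dots> = (\<integral>\<^sup>+x. f (vec_lambda x) \<partial>(\<Pi>\<^sub>M i\<in>UNIV. lborel))"
    by (subst split) auto
  also have "\<dots> = (\<integral>\<^sup>+x. f x \<partial>lborel)"
    by (simp add: lborel_vec_eq_PiM nn_integral_distr)
  finally show ?thesis .
qed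

text \<open>The preimage of a box is again a box, with the same side lengths in permuted order and
  hence the same volume; boxes determine Lebesgue measure.\<close>

lemma lborel_distr_swap:
  fixes m n :: "'n::finite"
  shows "distr lborel borel (\<lambda>x::real^'n. \<chi> i. x $ Transposition.transpose m n i) = lborel"
proof (rule lborel_eqI[symmetric])
  let ?h = "\<lambda>x::real^'n. \<chi> i. x $ Transposition.transpose m n i"
  fix l u :: "real^'n" assume le: "\<And>b. b \<in> Basis \<Longrightarrow> l \<bullet> b \<le> u \<bullet> b"
  have le': "l $ i \<le> u $ i" for i
    using le[of "axis i 1"] by (simp add: inner_axis axis_in_Basis_iff)
  have [measurable]: "?h \<in> borel_measurable borel"
    by (rule borel_measurable_vec_lambda) measurable
  have "?h -` box l u = box (?h l) (?h u)"
    by (auto simp: mem_box_cart) (metis transpose_involutory)+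
  then show "emeasure (distr lborel borel ?h) (box l u) = (\<Prod>b\<in>Basis. (u - l) \<bullet> b)"
    using le' prod.permute[OF permutes_swap_id[of m UNIV n], of "\<lambda>i. u $ i - l $ i"]
    by (simp add: emeasure_distr emeasure_lborel_box_eq Basis_vec_eq_range prod.reindex inj_axis
        inner_axis o_def)
qed simp

text \<open>A diagonal matrix scales each axis separately, so the coordinatewise affine rule
  applies, and the product of its scaling factors is the determinant.\<close>

lemma nn_integral_lborel_diagonal:
  fixes f :: "real^'n \<Rightarrow> ennreal" and A :: "real^'n^'n"
  assumes [measurable]: "f \<in> borel_measurable borel"
    and A: "\<And>i j. i \<noteq> j \<Longrightarrow> A $ i $ j = 0" "det A \<noteq> 0"
  shows "\<bar>det A\<bar> * (\<integral>\<^sup>+x. f (A *v x) \<partial>lborel) = (\<integral>\<^sup>+x. f x \<partial>lborel)"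
proof -
  \<comment> \<open>The affine rule takes one factor per basis vector rather than per index; on
    \<open>axis i 1\<close> this quadratic expression returns the diagonal entry
    \<open>A $ i $ i\<close>.\<close>
  define c where "c j = j \<bullet> (A *v j)" for j
  have c_axis: "c (axis i 1) = A $ i $ i" for i
    by (simp add: c_def inner_axis' matrix_vector_mult_def) (simp add: axis_def if_distrib cong: if_cong)
  have det: "det A = (\<Prod>i\<in>UNIV. A $ i $ i)"
    using A(1) by (rule det_diagonal)
  have nz: "c j \<noteq> 0" if "j \<in> Basis" for j
    using that A(2) by (auto simp: det Basis_vec_eq_range c_axis)
  have T: "0 + (\<Sum>j\<in>Basis. (c j * (x \<bullet> j)) *\<^sub>R j) = A *v x" for x
  proof -
    have "(A *v x) $ i = A $ i $ i * x $ i" for i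
      unfolding matrix_vector_mult_def using A(1)
      by simp (subst sum.remove[of _ i], auto intro!: sum.neutral)
    then show ?thesis
      by (simp add: vec_eq_iff Basis_vec_eq_range sum.reindex inj_axis c_axis inner_axis)
        (simp add: axis_def if_distrib cong: if_cong)
  qed
  have "lborel = density (distr lborel borel ((*v) A)) (\<lambda>_. \<bar>det A\<bar>)"
    using lborel_affine_euclidean[of c 0, OF nz] unfolding T
    by (simp add: Basis_vec_eq_range prod.reindex inj_axis c_axis det abs_prod)
  then have "(\<integral>\<^sup>+x. f x \<partial>lborel) = (\<integral>\<^sup>+x. f x \<partial>density (distr lborel borel ((*v) A)) (\<lambda>_. \<bar>det A\<bar>))"
    by simp
  then show ?thesis
    by (simp add: nn_integral_density nn_integral_distr nn_integral_cmult)
qed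

text \<open>
  The change-of-variables theorems of HOL-Analysis cover only index types of class wellorder;
  a decomposition into elementary matrices works for every finite index type.
\<close>
lemma nn_integral_lborel_linear:
  fixes f :: "real^'n \<Rightarrow> ennreal" and P :: "real^'n^'n"
  assumes "f \<in> borel_measurable borel" "det P \<noteq> 0"
  shows "\<bar>det P\<bar> * (\<integral>\<^sup>+x. f (P *v x) \<partial>lborel) = (\<integral>\<^sup>+x. f x \<partial>lborel)"
proof -
  \<comment> \<open>The induction claim quantifies over \<open>f\<close> because the product case
    uses the hypothesis on \<open>B\<close> for the function \<open>f\<close> composed with
    \<open>A\<close>.\<close>
  have "\<forall>f \<in> borel_measurable borel. det P \<noteq> 0 \<longrightarrow>
      ennreal \<bar>det P\<bar> * (\<integral>\<^sup>+x. f (P *v x) \<partial>lborel) = (\<integral>\<^sup>+x. f x \<partial>lborel)" (is "?Q P")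
  proof (rule induct_matrix_elementary_alt[where P = ?Q])
    fix A B :: "real^'n^'n" assume A: "?Q A" and B: "?Q B"
    show "?Q (A ** B)"
    proof (intro ballI impI)
      fix f :: "real^'n \<Rightarrow> ennreal"
      assume [measurable]: "f \<in> borel_measurable borel" and nz: "det (A ** B) \<noteq> 0"
      have B': "ennreal \<bar>det B\<bar> * (\<integral>\<^sup>+x. f (A *v (B *v x)) \<partial>lborel) = (\<integral>\<^sup>+x. f (A *v x) \<partial>lborel)"
        using bspec[OF B, of "\<lambda>x. f (A *v x)"] nz by (simp add: det_mul)
      have "ennreal \<bar>det (A ** B)\<bar> * (\<integral>\<^sup>+x. f ((A ** B) *v x) \<partial>lborel)
          = ennreal \<bar>det A\<bar> * (ennreal \<bar>det B\<bar> * (\<integral>\<^sup>+x. f (A *v (B *v x)) \<partial>lborel))"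
        by (simp add: det_mul abs_mult ennreal_mult mult.assoc matrix_vector_mul_assoc)
      also have "\<dots> = (\<integral>\<^sup>+x. f x \<partial>lborel)"
        unfolding B' using bspec[OF A, of f] nz by (simp add: det_mul)
      finally show "ennreal \<bar>det (A ** B)\<bar> * (\<integral>\<^sup>+x. f ((A ** B) *v x) \<partial>lborel) = (\<integral>\<^sup>+x. f x \<partial>lborel)" .
    qed
  next
    \<comment> \<open>A zero row makes the matrix singular, so the claim is vacuous here.\<close>
    fix A :: "real^'n^'n" and i assume "row i A = 0"
    then have "det A = 0" by (rule det_zero_row(1))
    then show "?Q A" by simp
  next
    fix A :: "real^'n^'n" assume "\<And>i j. i \<noteq> j \<Longrightarrow> A $ i $ j = 0"
    then show "?Q A" using nn_integral_lborel_diagonal[of _ A] by blast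
  next
    fix m n :: 'n assume "m \<noteq> n"
    let ?S = "(\<chi> i j. mat 1 $ i $ Transposition.transpose m n j) :: real^'n^'n"
    have det: "\<bar>det ?S\<bar> = 1"
      by (simp add: det_permute_columns permutes_swap_id sign_swap_id abs_mult)
    have S: "?S *v x = (\<chi> i. x $ Transposition.transpose m n i)" for x
    proof -
      have "?S $ i $ j * x $ j = (if j = Transposition.transpose m n i then x $ j else 0)" for i j
        by (auto simp: mat_def)
      then show ?thesis
        by (simp add: vec_eq_iff matrix_vector_mult_def)
    qed
    have [measurable]: "(\<lambda>x::real^'n. \<chi> i. x $ Transposition.transpose m n i) \<in> borel_measurable borel"
      by (rule borel_measurable_vec_lambda) measurable
    show "?Q ?S"
    proof (intro ballI impI)
      fix f :: "real^'n \<Rightarrow> ennreal" assume [measurable]: "f \<in> borel_measurable borel"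
      have "(\<integral>\<^sup>+x. f x \<partial>lborel) = (\<integral>\<^sup>+x. f x \<partial>distr lborel borel (\<lambda>x. \<chi> i. x $ Transposition.transpose m n i))"
        by (simp only: lborel_distr_swap)
      then show "ennreal \<bar>det ?S\<bar> * (\<integral>\<^sup>+x. f (?S *v x) \<partial>lborel) = (\<integral>\<^sup>+x. f x \<partial>lborel)"
        unfolding det S by (simp add: nn_integral_distr)
    qed
  next
    fix m n :: 'n assume mn: "m \<noteq> n"
    let ?S = "(\<chi> i j. of_bool (i = m \<and> j = n \<or> i = j)) :: real^'n^'n"
    \<comment> \<open>The shear matrix is the identity with row \<open>n\<close> added to row
      \<open>m\<close>, a row operation that preserves the determinant.\<close>
    have "?S = (\<chi> k. if k = m then row m (mat 1) + 1 *s row n (mat 1) else row k (mat 1))"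
      using mn by (auto simp: vec_eq_iff row_def mat_def)
    then have det: "\<bar>det ?S\<bar> = 1"
      by (simp only: det_row_operation[OF mn]) simp
    have S: "?S *v x = (\<chi> i. if i = m then x $ m + x $ n else x $ i)" for x
    proof -
      have "(\<Sum>j\<in>UNIV. of_bool (j = n \<or> m = j) * x $ j) = (\<Sum>j\<in>UNIV. of_bool (j = m) * x $ j + of_bool (j = n) * x $ j)"
        using mn by (intro sum.cong) auto
      then show ?thesis
        by (auto simp: vec_eq_iff matrix_vector_mult_def sum.distrib)
    qed
    show "?Q ?S"
      unfolding det S using nn_integral_lborel_shear[OF _ mn] by auto
  qed
  then show ?thesis using assms by blast
qed

section \<open>Reducing positive definite forms to the identity\<close>

lemma inner_matrix_vector_mult:
  fixes A :: "real^'n^'m"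
  shows "x \<bullet> (A *v y) = (transpose A *v x) \<bullet> y"
  by (simp add: dot_lmul_matrix transpose_matrix_vector)

text \<open>Gram--Schmidt for the inner product $x^t B y$.\<close>
lemma exists_congruent_to_id:
  fixes B :: "real^'n^'n"
  assumes sym: "transpose B = B" and pos: "\<And>x. x \<noteq> 0 \<Longrightarrow> x \<bullet> (B *v x) > 0"
  obtains Q :: "real^'n^'n" where "transpose Q ** B ** Q = mat 1"
proof -
  have symm: "x \<bullet> (B *v y) = y \<bullet> (B *v x)" for x y
    by (simp add: inner_matrix_vector_mult[of x] sym inner_commute)
  \<comment> \<open>The vectors are labelled by the index type itself, so the case
    \<open>S = UNIV\<close> supplies exactly the columns of a square matrix.\<close>
  have "\<exists>q :: 'n \<Rightarrow> real^'n. \<forall>i\<in>S. \<forall>j\<in>S. q i \<bullet> (B *v q j) = (if i = j then 1 else 0)" for S :: "'n set"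
    using finite[of S]
  proof (induction S)
    case empty
    then show ?case by simp
  next
    case (insert k S)
    then obtain q :: "'n \<Rightarrow> real^'n" where
      q: "\<And>i j. i \<in> S \<Longrightarrow> j \<in> S \<Longrightarrow> q i \<bullet> (B *v q j) = (if i = j then 1 else 0)"
      by blast
    \<comment> \<open>Fewer vectors than the dimension cannot span, so some \<open>x\<close> lies
      outside their span.\<close>
    have "card S < CARD('n)"
      using insert by (intro psubset_card_mono) auto
    then have "dim (q ` S) < DIM(real^'n)"
      using dim_le_card'[of "q ` S"] card_image_le[of S q] by simp
    then have "span (q ` S) \<noteq> UNIV"
      using dim_eq_full[of "q ` S"] by auto
    then obtain x where x: "x \<notin> span (q ` S)" by blast
    \<comment> \<open>Subtracting the \<open>B\<close>-orthogonal projection of \<open>x\<close>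
      leaves a vector orthogonal to the earlier ones. It is nonzero since \<open>x\<close> is
      outside their span, so positivity of the form allows it to be normalised to
      \<open>z\<close>.\<close>
    define y where "y = x - (\<Sum>i\<in>S. (q i \<bullet> (B *v x)) *\<^sub>R q i)"
    have "y \<noteq> 0"
    proof
      assume "y = 0"
      then have "x = (\<Sum>i\<in>S. (q i \<bullet> (B *v x)) *\<^sub>R q i)" by (simp add: y_def)
      also have "\<dots> \<in> span (q ` S)"
        by (intro span_sum span_scale span_base) auto
      finally show False using x by blast
    qed
    then have yy: "y \<bullet> (B *v y) > 0" by (rule pos)
    have qy: "q j \<bullet> (B *v y) = 0" if "j \<in> S" for j
    proof -
      have "q j \<bullet> (B *v y) = q j \<bullet> (B *v x) - (\<Sum>i\<in>S. (q i \<bullet> (B *v x)) * (q i \<bullet> (B *v q j)))"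
        unfolding symm[of "q j" y] by (simp add: y_def inner_diff_left inner_sum_left symm[of x])
      also have "(\<Sum>i\<in>S. (q i \<bullet> (B *v x)) * (q i \<bullet> (B *v q j))) = (\<Sum>i\<in>S. if i = j then q i \<bullet> (B *v x) else 0)"
        using that by (intro sum.cong) (auto simp: q)
      finally show ?thesis using that insert by simp
    qed
    define z where "z = (1 / sqrt (y \<bullet> (B *v y))) *\<^sub>R y"
    have zz: "z \<bullet> (B *v z) = 1"
      using yy by (simp add: z_def matrix_vector_mult_scaleR)
    have qz: "q j \<bullet> (B *v z) = 0" "z \<bullet> (B *v q j) = 0" if "j \<in> S" for j
      using qy[OF that] symm[of "q j" y] by (simp_all add: z_def matrix_vector_mult_scaleR)
    show ?case
    proof (intro exI[of _ "q(k := z)"] ballI)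
      fix i j assume "i \<in> insert k S" "j \<in> insert k S"
      then show "(q(k := z)) i \<bullet> (B *v (q(k := z)) j) = (if i = j then 1 else 0)"
        using zz qz q by (cases "i = k"; cases "j = k") simp_all
    qed
  qed
  from this[of UNIV] obtain q :: "'n \<Rightarrow> real^'n" where q: "\<And>i j. q i \<bullet> (B *v q j) = (if i = j then 1 else 0)"
    by blast
  \<comment> \<open>With the \<open>q j\<close> as columns, \<open>transpose Q ** B ** Q\<close> is
    their Gram matrix with respect to \<open>B\<close>.\<close>
  define Q :: "real^'n^'n" where "Q = (\<chi> i j. q j $ i)"
  have Q: "Q *v axis j 1 = q j" for j
    by (simp add: Q_def matrix_vector_mult_basis column_def vec_eq_iff)
  have "transpose Q ** B ** Q = mat 1"
  proof (subst vec_eq_iff, subst vec_eq_iff, intro allI)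
    fix i j
    have "(transpose Q ** B ** Q) $ i $ j = axis i 1 \<bullet> ((transpose Q ** B ** Q) *v axis j 1)"
      by (simp only: inner_axis' matrix_vector_mult_basis column_def) simp
    also have "\<dots> = q i \<bullet> (B *v q j)"
      by (simp only: matrix_vector_mul_assoc[symmetric] inner_matrix_vector_mult[of "axis i 1"] transpose_transpose Q)
    also have "\<dots> = mat 1 $ i $ j"
      by (simp add: q mat_def)
    finally show "(transpose Q ** B ** Q) $ i $ j = mat 1 $ i $ j" .
  qed
  then show thesis by (rule that)
qed

section \<open>Gaussian integrals\<close>

text \<open>Up to the normalising constant \<open>sqrt (2 * pi)\<close>, this is the known
  characteristic function of the standard normal distribution.\<close>

lemma has_bochner_integral_gaussian_iexp_real:
  "has_bochner_integral lborel (\<lambda>x. complex_of_real (exp (- x\<^sup>2 / 2)) * iexp (x * t))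
     (complex_of_real (sqrt (2 * pi) * exp (- t\<^sup>2 / 2)))"
proof -
  have eq: "complex_of_real (exp (- x\<^sup>2 / 2)) * iexp (x * t)
      = complex_of_real (sqrt (2 * pi)) * (std_normal_density x *\<^sub>R iexp (t * x))" for x
    by (simp add: std_normal_density_def scaleR_conv_of_real mult_ac)
  have "integrable std_normal_distribution (\<lambda>x. iexp (t * x))"
    by (intro finite_measure.integrable_const_bound[where B = 1] prob_space.finite_measure
        prob_space_normal_density) auto
  then have "integrable lborel (\<lambda>x. std_normal_density x *\<^sub>R iexp (t * x))"
    by (subst (asm) integrable_density) auto
  moreover have "(\<integral>x. std_normal_density x *\<^sub>R iexp (t * x) \<partial>lborel) = complex_of_real (exp (- t\<^sup>2 / 2))"
    using fun_cong[OF char_std_normal_distribution, of t] unfolding char_def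
    by (subst (asm) integral_density) auto
  ultimately have "has_bochner_integral lborel (\<lambda>x. std_normal_density x *\<^sub>R iexp (t * x)) (complex_of_real (exp (- t\<^sup>2 / 2)))"
    by (simp add: has_bochner_integral_iff)
  then show ?thesis
    unfolding eq of_real_mult[of "sqrt (2 * pi)"] by (rule has_bochner_integral_mult_right)
qed

text \<open>Both the Gaussian and the phase factor over the coordinates, so the integral is a
  product of one-dimensional ones. It will serve as the \<open>p\<close>-integral for fixed
  \<open>s\<close>.\<close>

lemma has_bochner_integral_gaussian_iexp:
  fixes v :: "real^'n"
  shows "has_bochner_integral lborel (\<lambda>x. complex_of_real (exp (- (norm x)\<^sup>2 / 2)) * iexp (x \<bullet> v))
     (complex_of_real ((2 * pi) powr (real CARD('n) / 2) * exp (- (norm v)\<^sup>2 / 2)))"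
proof -
  interpret product_sigma_finite "\<lambda>_::'n. lborel :: real measure" by standard
  let ?f = "\<lambda>i x. complex_of_real (exp (- x\<^sup>2 / 2)) * iexp (x * v $ i)"
  have norm2: "(norm x)\<^sup>2 = (\<Sum>i\<in>UNIV. (x $ i)\<^sup>2)" for x :: "real^'n"
    unfolding power2_norm_eq_inner inner_vec_def by (simp add: power2_eq_square)
  have exp_norm: "exp (- (norm x)\<^sup>2 / 2) = (\<Prod>i\<in>UNIV. exp (- (x $ i)\<^sup>2 / 2))" for x :: "real^'n"
    by (simp add: norm2 sum_negf[symmetric] sum_divide_distrib exp_sum del: sum_negf)
  have f: "complex_of_real (exp (- (norm x)\<^sup>2 / 2)) * iexp (x \<bullet> v) = (\<Prod>i\<in>UNIV. ?f i (x $ i))" for x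
    by (simp only: exp_norm of_real_prod prod.distrib) (simp add: inner_vec_def sum_distrib_left exp_sum)
  have int: "integrable lborel (?f i)"
    and val: "(\<integral>x. ?f i x \<partial>lborel) = complex_of_real (sqrt (2 * pi) * exp (- (v $ i)\<^sup>2 / 2))" for i
    using has_bochner_integral_gaussian_iexp_real[of "v $ i"] by (simp_all only: has_bochner_integral_iff)
  have "integrable (\<Pi>\<^sub>M i\<in>UNIV. lborel) (\<lambda>x. \<Prod>i\<in>UNIV. ?f i (x i))"
    by (rule product_integrable_prod) (use int in auto)
  moreover have "(\<integral>x. (\<Prod>i\<in>UNIV. ?f i (x i)) \<partial>(\<Pi>\<^sub>M i\<in>UNIV. lborel))
      = (\<Prod>i\<in>UNIV. complex_of_real (sqrt (2 * pi) * exp (- (v $ i)\<^sup>2 / 2)))"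
    by (subst product_integral_prod) (use int in \<open>auto simp only: val finite\<close>)
  moreover have "(\<Prod>i\<in>(UNIV::'n set). complex_of_real (sqrt (2 * pi) * exp (- (v $ i)\<^sup>2 / 2)))
      = complex_of_real ((2 * pi) powr (real CARD('n) / 2) * exp (- (norm v)\<^sup>2 / 2))"
    by (simp only: exp_norm of_real_prod[symmetric] prod.distrib)
      (simp add: powr_half_sqrt[symmetric] powr_power)
  moreover have "(\<lambda>x::real^'n. \<Prod>i\<in>UNIV. ?f i (x $ i)) \<in> borel_measurable borel"
    by measurable
  ultimately show ?thesis
    unfolding f lborel_vec_eq_PiM
    by (simp add: has_bochner_integral_iff integrable_distr_eq integral_distr)
qed

lemma nn_integral_gaussian:
  "(\<integral>\<^sup>+x. ennreal (exp (- (norm (x::real^'n))\<^sup>2 / 2)) \<partial>lborel) = ennreal ((2 * pi) powr (real CARD('n) / 2))"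
proof -
  have "has_bochner_integral lborel (\<lambda>x::real^'n. complex_of_real (exp (- (norm x)\<^sup>2 / 2)))
      (complex_of_real ((2 * pi) powr (real CARD('n) / 2)))"
    using has_bochner_integral_gaussian_iexp[of "0::real^'n"] by simp
  then have "has_bochner_integral lborel (\<lambda>x::real^'n. exp (- (norm x)\<^sup>2 / 2)) ((2 * pi) powr (real CARD('n) / 2))"
    unfolding has_bochner_integral_iff by (auto simp: complex_of_real_integrable_eq simp del: of_real_exp)
  then show ?thesis
    by (auto simp: has_bochner_integral_iff nn_integral_eq_integral)
qed

text \<open>Substituting \<open>Q *v x\<close> for \<open>x\<close>, where \<open>Q\<close> carries
  \<open>B\<close> to the identity by congruence, gives the standard Gaussian. The Jacobian is fixed
  by the determinant of the congruence.\<close>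

lemma has_bochner_integral_gaussian_quadratic:
  fixes B :: "real^'n^'n"
  assumes sym: "transpose B = B" and pos: "\<And>x. x \<noteq> 0 \<Longrightarrow> x \<bullet> (B *v x) > 0"
  shows "has_bochner_integral lborel (\<lambda>x. exp (- (x \<bullet> (B *v x)) / 2))
     ((2 * pi) powr (real CARD('n) / 2) * det B powr (-1/2))"
proof -
  obtain Q :: "real^'n^'n" where Q: "transpose Q ** B ** Q = mat 1"
    using exists_congruent_to_id[OF assms] .
  \<comment> \<open>Taking determinants of \<open>transpose Q ** B ** Q = mat 1\<close> shows that
    \<open>Q\<close> is invertible and that its Jacobian is the inverse square root of
    \<open>det B\<close>.\<close>
  have det: "(det Q)\<^sup>2 * det B = 1"
    using arg_cong[OF Q, of det] by (simp add: det_mul power2_eq_square mult_ac)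
  then have nz: "det Q \<noteq> 0" by auto
  have "det B = (1 / \<bar>det Q\<bar>)\<^sup>2"
    using det nz by (simp add: field_simps)
  also have "\<dots> powr (-1/2) = \<bar>det Q\<bar>"
    using nz by (simp add: powr_powr powr_minus flip: powr_numeral)
  finally have absQ: "\<bar>det Q\<bar> = det B powr (-1/2)" by simp
  have quad: "(Q *v x) \<bullet> (B *v (Q *v x)) = (norm x)\<^sup>2" for x
  proof -
    have "(Q *v x) \<bullet> (B *v (Q *v x)) = x \<bullet> ((transpose Q ** B ** Q) *v x)"
      by (simp only: matrix_vector_mul_assoc[symmetric] inner_matrix_vector_mult[of x] transpose_transpose)
    then show ?thesis by (simp add: Q power2_norm_eq_inner)
  qed
  have meas: "(\<lambda>x. exp (- (x \<bullet> (B *v x)) / 2)) \<in> borel_measurable borel"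
    by measurable
  have "(\<integral>\<^sup>+x. ennreal (exp (- (x \<bullet> (B *v x)) / 2)) \<partial>lborel)
      = ennreal \<bar>det Q\<bar> * (\<integral>\<^sup>+x. ennreal (exp (- (norm (x::real^'n))\<^sup>2 / 2)) \<partial>lborel)"
    using nn_integral_lborel_linear[symmetric, of "\<lambda>x. ennreal (exp (- (x \<bullet> (B *v x)) / 2))" Q] meas nz
    by (simp add: quad)
  also have "\<dots> = ennreal ((2 * pi) powr (real CARD('n) / 2) * det B powr (-1/2))"
    by (simp only: nn_integral_gaussian absQ ennreal_mult[symmetric] powr_ge_zero mult.commute)
  finally show ?thesis
    using meas by (intro has_bochner_integral_nn_integral) auto
qed

text \<open>The integrand is what remains after the \<open>p\<close>-integration with
  \<open>v\<close> equal to \<open>\<tau>\<close> times \<open>A *v s\<close>. Its exponent is the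
  quadratic form of the matrix in the determinant, which is positive definite because the identity
  summand already is.\<close>

lemma has_bochner_integral_gaussian_image:
  fixes A :: "real^'n^'m"
  shows "has_bochner_integral lborel
     (\<lambda>s. exp (- (norm s)\<^sup>2 / 2) * ((2 * pi) powr (real CARD('m) / 2) * exp (- (norm (\<tau> *\<^sub>R (A *v s)))\<^sup>2 / 2)))
     ((2 * pi) powr ((real CARD('n) + real CARD('m)) / 2) *
      det (mat 1 + \<tau>\<^sup>2 *\<^sub>R (transpose A ** A)) powr (-1/2))"
proof -
  let ?B = "mat 1 + \<tau>\<^sup>2 *\<^sub>R (transpose A ** A)"
  have quad: "x \<bullet> (?B *v x) = (norm x)\<^sup>2 + (norm (\<tau> *\<^sub>R (A *v x)))\<^sup>2" for x
  proof -
    have "x \<bullet> ((transpose A ** A) *v x) = (A *v x) \<bullet> (A *v x)"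
      by (simp only: matrix_vector_mul_assoc[symmetric] inner_matrix_vector_mult[of x] transpose_transpose)
    then show ?thesis
      unfolding power2_norm_eq_inner
      by (simp add: matrix_vector_mult_add_rdistrib scaleR_matrix_vector_assoc[symmetric] inner_add_right
          power2_eq_square)
  qed
  have sym: "transpose ?B = ?B"
    by (simp add: transpose_def vec_eq_iff mat_def matrix_matrix_mult_def mult.commute)
  have pos: "x \<bullet> (?B *v x) > 0" if "x \<noteq> 0" for x
    unfolding quad using that by (intro add_pos_nonneg) auto
  have exp_quad: "exp (- (x \<bullet> (?B *v x)) / 2) = exp (- (norm x)\<^sup>2 / 2) * exp (- (norm (\<tau> *\<^sub>R (A *v x)))\<^sup>2 / 2)" for x
    unfolding quad exp_add[symmetric] by (rule arg_cong[where f = exp]) argo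
  have powr: "(2 * pi) powr ((real CARD('n) + real CARD('m)) / 2)
      = (2 * pi) powr (real CARD('m) / 2) * (2 * pi) powr (real CARD('n) / 2)"
    by (simp add: powr_add[symmetric] add_divide_distrib add.commute)
  have "has_bochner_integral lborel
     (\<lambda>s. (2 * pi) powr (real CARD('m) / 2) * (exp (- (norm s)\<^sup>2 / 2) * exp (- (norm (\<tau> *\<^sub>R (A *v s)))\<^sup>2 / 2)))
     ((2 * pi) powr (real CARD('m) / 2) * ((2 * pi) powr (real CARD('n) / 2) * det ?B powr (-1/2)))"
    using has_bochner_integral_gaussian_quadratic[OF sym pos] unfolding exp_quad
    by (rule has_bochner_integral_mult_right)
  then show ?thesis
    by (simp only: powr mult.assoc mult.left_commute[of "exp _"])
qed

section \<open>Families of Gaussian pairs and the identity for a fixed matrix\<close>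

text \<open>Products of exponentials, separated into an \<open>s\<close> part and a \<open>p\<close>
  part, fit the integration rules for product measures; the theorem's exponential of a sum is
  matched to this form later.\<close>

definition gaussian_weight :: "nat set \<Rightarrow> (nat \<Rightarrow> real^'n) \<times> (nat \<Rightarrow> real^'m) \<Rightarrow> real" where
  "gaussian_weight I = (\<lambda>(s, p). (\<Prod>i\<in>I. exp (- (norm (s i))\<^sup>2 / 2)) * (\<Prod>i\<in>I. exp (- (norm (p i))\<^sup>2 / 2)))"

abbreviation (input) lborel_pairs ::
  "nat set \<Rightarrow> ((nat \<Rightarrow> real^'n) \<times> (nat \<Rightarrow> real^'m)) measure" where
  "lborel_pairs I \<equiv> (\<Pi>\<^sub>M i\<in>I. lborel) \<Otimes>\<^sub>M (\<Pi>\<^sub>M i\<in>I. lborel)"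

lemma pair_sigma_finite_PiM_lborel:
  assumes "finite I"
  shows "pair_sigma_finite (\<Pi>\<^sub>M i\<in>I. (lborel :: 'a::euclidean_space measure)) (\<Pi>\<^sub>M i\<in>I. (lborel :: 'b::euclidean_space measure))"
proof -
  interpret S: product_sigma_finite "\<lambda>_. lborel :: 'a measure" by standard
  interpret P: product_sigma_finite "\<lambda>_. lborel :: 'b measure" by standard
  show ?thesis
    using assms by (intro pair_sigma_finite.intro S.sigma_finite P.sigma_finite)
qed

lemma integrable_gaussian: "integrable lborel (\<lambda>x::real^'n. exp (- (norm x)\<^sup>2 / 2))"
  by (rule integrableI_nonneg) (use nn_integral_gaussian[where 'n='n] in auto)

lemma gaussian_weight_nonneg: "gaussian_weight I z \<ge> 0"
  by (cases z) (auto simp: gaussian_weight_def intro!: mult_nonneg_nonneg prod_nonneg)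

text \<open>Supplies the dominating function for every later use of Fubini, since all remaining
  factors of the integrands are phases of modulus 1.\<close>

lemma integrable_gaussian_weight:
  assumes "finite I"
  shows "integrable (lborel_pairs I) (gaussian_weight I :: (nat \<Rightarrow> real^'n) \<times> (nat \<Rightarrow> real^'m) \<Rightarrow> real)"
proof -
  interpret S: product_sigma_finite "\<lambda>_::nat. lborel :: (real^'n) measure" by standard
  interpret P: product_sigma_finite "\<lambda>_::nat. lborel :: (real^'m) measure" by standard
  interpret pair_sigma_finite "\<Pi>\<^sub>M i\<in>I. (lborel :: (real^'n) measure)" "\<Pi>\<^sub>M i\<in>I. (lborel :: (real^'m) measure)"
    using assms by (rule pair_sigma_finite_PiM_lborel)
  have S: "integrable (\<Pi>\<^sub>M i\<in>I. lborel) (\<lambda>s. \<Prod>i\<in>I. exp (- (norm (s i :: real^'n))\<^sup>2 / 2))"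
    using assms integrable_gaussian by (intro S.product_integrable_prod) auto
  have P: "integrable (\<Pi>\<^sub>M i\<in>I. lborel) (\<lambda>s. \<Prod>i\<in>I. exp (- (norm (s i :: real^'m))\<^sup>2 / 2))"
    using assms integrable_gaussian by (intro P.product_integrable_prod) auto
  have "integrable (lborel_pairs I)
     (\<lambda>z. (\<Prod>i\<in>I. exp (- (norm (fst z i :: real^'n))\<^sup>2 / 2)) * (\<Prod>i\<in>I. exp (- (norm (snd z i :: real^'m))\<^sup>2 / 2)))"
    by (rule Fubini_integrable) (use S P in \<open>auto simp: abs_mult prod_nonneg\<close>)
  then show ?thesis by (simp add: gaussian_weight_def case_prod_beta')
qed

text \<open>By Fubini the \<open>p\<close>-integral comes first. For fixed \<open>s\<close> it
  splits over \<open>i\<close> into Gaussian Fourier transforms, and the resulting function of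
  \<open>s\<close> again splits over \<open>i\<close>, each factor producing one
  determinant.\<close>

lemma has_bochner_integral_gaussian_bilinear:
  fixes A :: "real^'n^'m" and t :: "nat \<Rightarrow> real"
  assumes "finite I"
  defines "h \<equiv> \<lambda>(s, p). complex_of_real (gaussian_weight I (s, p)) *
     (\<Prod>i\<in>I. iexp (p i \<bullet> (t i *\<^sub>R (A *v s i))))"
  shows "has_bochner_integral (lborel_pairs I) h
    (complex_of_real ((2 * pi) powr (real (card I) * (real CARD('n) + real CARD('m)) / 2) *
      (\<Prod>i\<in>I. det (mat 1 + (t i)\<^sup>2 *\<^sub>R (transpose A ** A))) powr (-1/2)))"
proof -
  interpret S: product_sigma_finite "\<lambda>_::nat. lborel :: (real^'n) measure" by standard
  interpret P: product_sigma_finite "\<lambda>_::nat. lborel :: (real^'m) measure" by standard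
  interpret pair_sigma_finite "\<Pi>\<^sub>M i\<in>I. (lborel :: (real^'n) measure)" "\<Pi>\<^sub>M i\<in>I. (lborel :: (real^'m) measure)"
    using assms by (intro pair_sigma_finite_PiM_lborel)
  let ?k = "\<lambda>i s. exp (- (norm s)\<^sup>2 / 2) * ((2 * pi) powr (real CARD('m) / 2) * exp (- (norm (t i *\<^sub>R (A *v s)))\<^sup>2 / 2))"
  let ?d = "\<lambda>i. det (mat 1 + (t i)\<^sup>2 *\<^sub>R (transpose A ** A))"
  let ?u = "\<lambda>i s p. complex_of_real (exp (- (norm p)\<^sup>2 / 2)) * iexp (p \<bullet> (t i *\<^sub>R (A *v s)))"
  have meas_h: "h \<in> borel_measurable (lborel_pairs I)"
    unfolding h_def gaussian_weight_def by measurable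
  have int_h: "integrable (lborel_pairs I) h"
    by (rule Bochner_Integration.integrable_bound[OF integrable_gaussian_weight[OF assms(1)] meas_h])
      (auto simp: h_def norm_mult gaussian_weight_nonneg prod_norm[symmetric])
  have u: "has_bochner_integral lborel (?u i s)
     (complex_of_real ((2 * pi) powr (real CARD('m) / 2) * exp (- (norm (t i *\<^sub>R (A *v s)))\<^sup>2 / 2)))" for i s
    by (rule has_bochner_integral_gaussian_iexp)
  have inner: "(\<integral>p. h (s, p) \<partial>(\<Pi>\<^sub>M i\<in>I. lborel)) = (\<Prod>i\<in>I. complex_of_real (?k i (s i)))" for s
  proof -
    have "h (s, p) = (\<Prod>i\<in>I. complex_of_real (exp (- (norm (s i))\<^sup>2 / 2))) * (\<Prod>i\<in>I. ?u i (s i) (p i))" for p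
      unfolding h_def gaussian_weight_def prod.distrib split_conv of_real_mult of_real_prod mult.assoc ..
    moreover have "(\<integral>p. (\<Prod>i\<in>I. ?u i (s i) (p i)) \<partial>(\<Pi>\<^sub>M i\<in>I. lborel))
        = (\<Prod>i\<in>I. complex_of_real ((2 * pi) powr (real CARD('m) / 2) * exp (- (norm (t i *\<^sub>R (A *v s i)))\<^sup>2 / 2)))"
      using assms(1) u by (subst P.product_integral_prod) (auto simp only: has_bochner_integral_iff)
    ultimately show ?thesis
      unfolding of_real_mult[of "exp _"] prod.distrib[of "\<lambda>i. complex_of_real (exp (- (norm (s i))\<^sup>2 / 2))"]
      by (simp only: Bochner_Integration.integral_mult_right_zero)
  qed
  have k: "has_bochner_integral lborel (\<lambda>s. complex_of_real (?k i s))
     (complex_of_real ((2 * pi) powr ((real CARD('n) + real CARD('m)) / 2) * ?d i powr (-1/2)))" for i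
    by (rule has_bochner_integral_of_real) (rule has_bochner_integral_gaussian_image)
  have "integral\<^sup>L (lborel_pairs I) h = (\<integral>s. (\<integral>p. h (s, p) \<partial>(\<Pi>\<^sub>M i\<in>I. lborel)) \<partial>(\<Pi>\<^sub>M i\<in>I. lborel))"
    using integral_fst'[OF int_h] by simp
  also have "\<dots> = (\<Prod>i\<in>I. complex_of_real ((2 * pi) powr ((real CARD('n) + real CARD('m)) / 2) * ?d i powr (-1/2)))"
    unfolding inner using assms(1) k
    by (subst S.product_integral_prod) (auto simp only: has_bochner_integral_iff)
  also have "\<dots> = complex_of_real ((2 * pi) powr (real (card I) * (real CARD('n) + real CARD('m)) / 2) *
      (\<Prod>i\<in>I. ?d i) powr (-1/2))"
    by (simp only: of_real_prod[symmetric] prod.distrib prod_powr_distrib prod_constant powr_power)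
      (simp add: powr_power mult.commute)
  finally show ?thesis
    using int_h by (simp add: has_bochner_integral_iff)
qed

section \<open>Averaging over the random matrix\<close>

theorem proposition1:
  fixes M :: "'w measure"
    and A :: "'w \<Rightarrow> real ^ 'n ^ 'm"
    and g :: "'m \<Rightarrow> 'n \<Rightarrow> real \<Rightarrow> complex"
    and r :: nat
    and t :: "nat \<Rightarrow> real"
  assumes "prob_space M"
    and "prob_space.indep_vars M (\<lambda>_. borel) (\<lambda>(j, k) \<omega>. A \<omega> $ j $ k) (UNIV :: ('m \<times> 'n) set)"
    and "\<And>j k. g j k = char (distr M borel (\<lambda>\<omega>. A \<omega> $ j $ k))"
    and "r \<ge> 1"
    and "\<And>i. i \<in> {1..r} \<Longrightarrow> t i > 0"
  defines "L \<equiv> \<lambda>\<omega>. (\<Prod>i=1..r. det (mat 1 + (t i)\<^sup>2 *\<^sub>R (transpose (A \<omega>) ** A \<omega>))) powr (-1/2)"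
    and "\<mu> \<equiv> (\<Pi>\<^sub>M i\<in>{1..r}. (lborel :: (real ^ 'n) measure)) \<Otimes>\<^sub>M
              (\<Pi>\<^sub>M i\<in>{1..r}. (lborel :: (real ^ 'm) measure))"
    and "F \<equiv> \<lambda>(s :: nat \<Rightarrow> real ^ 'n, p :: nat \<Rightarrow> real ^ 'm).
              complex_of_real (exp (- (\<Sum>i=1..r. (norm (s i))\<^sup>2 / 2 + (norm (p i))\<^sup>2 / 2))) *
              (\<Prod>j\<in>UNIV. \<Prod>k\<in>UNIV. g j k (\<Sum>i=1..r. t i * p i $ j * s i $ k))"
  shows "integrable M L \<and> integrable \<mu> F \<and>
    complex_of_real (integral\<^sup>L M L) =
      complex_of_real ((2 * pi) powr (- (real r * (real CARD('n) + real CARD('m))) / 2)) *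
      integral\<^sup>L \<mu> F"
proof -
  interpret prob_space M by fact
  interpret SP: pair_sigma_finite "\<Pi>\<^sub>M i\<in>{1..r}. (lborel :: (real^'n) measure)" "\<Pi>\<^sub>M i\<in>{1..r}. (lborel :: (real^'m) measure)"
    by (rule pair_sigma_finite_PiM_lborel) simp
  interpret \<mu>: sigma_finite_measure \<mu>
    unfolding \<mu>_def by (rule SP.sigma_finite_measure_axioms)
  interpret M\<mu>: pair_sigma_finite M \<mu> ..
  note indep = assms(2)
  have [measurable]: "(\<lambda>\<omega>. A \<omega> $ j $ k) \<in> borel_measurable M" for j k
    using indep by (fastforce simp: indep_vars_def2)
  define \<theta> where "\<theta> j k = (\<lambda>(s, p). \<Sum>i=1..r. t i * p i $ j * s i $ k)"
    for j :: 'm and k :: 'n and z :: "(nat \<Rightarrow> real^'n) \<times> (nat \<Rightarrow> real^'m)"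
  have [measurable]: "\<theta> j k \<in> borel_measurable \<mu>" for j k
    unfolding \<theta>_def \<mu>_def by measurable
  let ?w = "gaussian_weight {1..r} :: (nat \<Rightarrow> real^'n) \<times> (nat \<Rightarrow> real^'m) \<Rightarrow> real"
  \<comment> \<open>\<open>H\<close> is the integrand before any averaging: its
    \<open>z\<close>-integral will be a multiple of \<open>L\<close>, and its expectation will be
    \<open>F\<close>.\<close>
  define H where "H = (\<lambda>\<omega> z. complex_of_real (?w z) * (\<Prod>j\<in>UNIV. \<Prod>k\<in>UNIV. iexp (\<theta> j k z * A \<omega> $ j $ k)))"
  have int_w: "integrable \<mu> ?w"
    unfolding \<mu>_def by (rule integrable_gaussian_weight) simp
  note [measurable] = borel_measurable_integrable[OF int_w]
  \<comment> \<open>The weight does not depend on \<open>\<omega>\<close>, and \<open>M\<close> has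
    total mass 1, so it stays integrable on the product space and dominates
    \<open>H\<close>.\<close>
  have "integrable (M \<Otimes>\<^sub>M \<mu>) (\<lambda>x. ?w (snd x))"
    by (rule M\<mu>.Fubini_integrable) (use int_w in auto)
  moreover have "(\<lambda>(\<omega>, z). H \<omega> z) \<in> borel_measurable (M \<Otimes>\<^sub>M \<mu>)"
    unfolding H_def by measurable
  ultimately have int_H: "integrable (M \<Otimes>\<^sub>M \<mu>) (\<lambda>(\<omega>, z). H \<omega> z)"
    by (rule Bochner_Integration.integrable_bound)
      (auto simp: H_def norm_mult gaussian_weight_nonneg prod_norm[symmetric])
  define c where "c = (2 * pi) powr (real r * (real CARD('n) + real CARD('m)) / 2)"
  \<comment> \<open>Exchanging the finite sums turns the entrywise phase, suited to independence,
    into the bilinear phase, suited to Gaussian integration.\<close>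
  have H_phase: "(\<Prod>j\<in>UNIV. \<Prod>k\<in>UNIV. iexp (\<theta> j k (s, p) * A \<omega> $ j $ k)) =
      (\<Prod>i=1..r. iexp (p i \<bullet> (t i *\<^sub>R (A \<omega> *v s i))))" for \<omega> s p
  proof -
    have "(\<Sum>j\<in>UNIV. \<Sum>k\<in>UNIV. \<theta> j k (s, p) * A \<omega> $ j $ k)
        = (\<Sum>j\<in>UNIV. \<Sum>k\<in>UNIV. \<Sum>i=1..r. p i $ j * (t i * (A \<omega> $ j $ k * s i $ k)))"
      unfolding \<theta>_def split_conv sum_distrib_right by (intro sum.cong refl) (simp only: mult_ac)
    also have "\<dots> = (\<Sum>j\<in>UNIV. \<Sum>i=1..r. \<Sum>k\<in>UNIV. p i $ j * (t i * (A \<omega> $ j $ k * s i $ k)))"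
      by (intro sum.cong refl sum.swap)
    also have "\<dots> = (\<Sum>i=1..r. \<Sum>j\<in>UNIV. \<Sum>k\<in>UNIV. p i $ j * (t i * (A \<omega> $ j $ k * s i $ k)))"
      by (rule sum.swap)
    also have "\<dots> = (\<Sum>i=1..r. p i \<bullet> (t i *\<^sub>R (A \<omega> *v s i)))"
      by (simp add: inner_vec_def matrix_vector_mult_def sum_distrib_left)
    finally show ?thesis
      by (simp only: exp_sum[symmetric] sum_distrib_left[symmetric] of_real_sum[symmetric] finite finite_atLeastAtMost)
  qed
  have int_\<mu>: "(\<integral>z. H \<omega> z \<partial>\<mu>) = complex_of_real (c * L \<omega>)" for \<omega>
  proof -
    have "H \<omega> = (\<lambda>(s, p). complex_of_real (?w (s, p)) * (\<Prod>i=1..r. iexp (p i \<bullet> (t i *\<^sub>R (A \<omega> *v s i)))))"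
      by (rule ext) (simp only: split_paired_all H_def H_phase split_conv)
    then show ?thesis
      using has_bochner_integral_gaussian_bilinear[of "{1..r}" t "A \<omega>"]
      unfolding \<mu>_def[symmetric] by (simp add: has_bochner_integral_iff c_def L_def)
  qed
  have int_M: "(\<integral>\<omega>. H \<omega> z \<partial>M) = F z" for z
  proof -
    obtain s p where z: "z = (s, p)" by (cases z)
    have w: "?w z = exp (- (\<Sum>i=1..r. (norm (s i))\<^sup>2 / 2 + (norm (p i))\<^sup>2 / 2))"
      by (simp add: z gaussian_weight_def exp_sum[symmetric] exp_add[symmetric] sum_negf sum.distrib)
    \<comment> \<open>For fixed \<open>z\<close> each phase is a measurable function of a single
      entry, so the phases inherit independence and the expectation of their product
      factors.\<close>
    have ind: "indep_vars (\<lambda>_. borel) (\<lambda>jk \<omega>. iexp (\<theta> (fst jk) (snd jk) z * A \<omega> $ fst jk $ snd jk)) (UNIV :: ('m \<times> 'n) set)"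
      using indep_vars_compose2[OF indep, of "\<lambda>jk x. iexp (\<theta> (fst jk) (snd jk) z * x)" "\<lambda>_. borel"]
      by (simp add: case_prod_beta')
    have "(\<integral>\<omega>. (\<Prod>jk\<in>(UNIV :: ('m \<times> 'n) set). iexp (\<theta> (fst jk) (snd jk) z * A \<omega> $ fst jk $ snd jk)) \<partial>M)
        = (\<Prod>jk\<in>(UNIV :: ('m \<times> 'n) set). \<integral>\<omega>. iexp (\<theta> (fst jk) (snd jk) z * A \<omega> $ fst jk $ snd jk) \<partial>M)"
      by (rule indep_vars_lebesgue_integral[OF _ ind]) (auto intro!: integrable_const_bound[where B = 1])
    also have "\<dots> = (\<Prod>jk\<in>(UNIV :: ('m \<times> 'n) set). g (fst jk) (snd jk) (\<theta> (fst jk) (snd jk) z))"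
      by (simp add: assms(3) char_def integral_distr)
    finally have "(\<integral>\<omega>. (\<Prod>j\<in>UNIV. \<Prod>k\<in>UNIV. iexp (\<theta> j k z * A \<omega> $ j $ k)) \<partial>M)
        = (\<Prod>j\<in>UNIV. \<Prod>k\<in>UNIV. g j k (\<theta> j k z))"
      by (simp only: prod.cartesian_product UNIV_Times_UNIV case_prod_beta')
    then show ?thesis
      unfolding H_def Bochner_Integration.integral_mult_right_zero w by (simp add: F_def z \<theta>_def)
  qed
  have c: "c > 0" by (simp add: c_def)
  \<comment> \<open>Integrability of \<open>L\<close> and \<open>F\<close> comes from the two
    marginals of \<open>H\<close>; since \<open>c\<close> is positive it can be divided out.\<close>
  have "integrable M (\<lambda>\<omega>. complex_of_real (c * L \<omega>))"
    using M\<mu>.integrable_fst[OF int_H] by (simp only: int_\<mu>)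
  then have "integrable M (\<lambda>\<omega>. c * L \<omega>)"
    by (simp only: complex_of_real_integrable_eq)
  then have L: "integrable M L"
    using c by simp
  moreover have "integrable \<mu> F"
    using M\<mu>.integrable_snd[OF int_H] by (simp add: int_M)
  moreover have "complex_of_real (c * integral\<^sup>L M L) = integral\<^sup>L \<mu> F"
    using M\<mu>.Fubini_integral[OF int_H] L by (simp add: int_M int_\<mu>)
  \<comment> \<open>The prefactor in the claim is the reciprocal of \<open>c\<close>, which turns
    the Fubini identity into the stated one.\<close>
  moreover have "(2 * pi) powr (- (real r * (real CARD('n) + real CARD('m))) / 2) * c = 1"
    by (simp add: c_def flip: powr_add)
  ultimately show ?thesis
    by (metis (no_types, lifting) mult.assoc mult_1 of_real_mult)
qed

end
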